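(* Given a strongly connected directed graph $G$ on $n$ nodes and a row stochastic consensus protocol $P$, if consensus is run on $G$ with random delays up to $B\ge1$ using the updates $\widehat x(t+1)=\widehat P(t+1)\widehat x(t)$, $t\ge0$, with the random delay matrices $\widehat P(t)$, then (almost surely) all compute nodes of $G$ asymptotically reach consensus on a value $v$ that is a convex combination of their initial values; i.e. $\widehat x_i(t)\to v$ as $t\to\infty$ for all $1\le i\le n$, with $v$ a convex combination of $\widehat x_1(0),\dots,\widehat x_n(0)$.
   Context: Protocol: $P=(p_{ij})$ is an $n\times n$ nonnegative row stochastic matrix respecting $G=(V,E)$: for $i\ne j$, $p_{ij}>0$ iff $(j,i)\in E$ (i.e. $j$ sends to $i$), and every node has a self-loop, $p_{ii}>0$. Let $m$ be the number of directed edges, not counting self-loops. Random delay model: for each directed edge $e=(j,i)$, $j\ne i$, and each $\ell=1,\dots,B$ there is a chain of virtual delay nodes $d^\ell_1(e),\dots,d^\ell_\ell(e)$; in total $b=mB(B+1)/2$ delay nodes, indexed $n+1,\dots,n+b$ after the compute nodes $1,\dots,n$. At each iteration $t\ge1$ every edge $e$ carries a message with random delay $\tau_e(t)\in\{0,\dots,B\}$; the $\tau_e(t)$ are i.i.d. over edges and times with an arbitrary distribution on $\{0,\dots,B\}$. Define: - $L(t)\in\{0,1\}^{n\times n}$: $L_{ij}(t)=1$ iff $e=(j,i)$ is an edge, $i\ne j$, and $\tau_e(t)=0$. - $R(t)\in\{0,1\}^{b\times n}$: $R(t)_{d,j}=1$ iff $d=d^\ell_1(e)$ for an edge $e=(j,i)$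 with $\tau_e(t)=\ell\ge1$. - $C\in\{0,1\}^{b\times b}$: $C_{d',d}=1$ iff $d=d^\ell_k(e)$ and $d'=d^\ell_{k+1}(e)$ for some $e,\ell,k$. - $\phi(t)\in\{0,1\}^b$: $\phi(0)=0$, $\phi(t)=R(t)\mathbf 1_n+C\phi(t-1)$ (indicator of which delay nodes are non-empty). - $\widehat w_{ij}(t)$: the number of $\ell\in\{1,\dots,B\}$ with $\phi_d(t-1)=1$ for $d=d^\ell_\ell((j,i))$. - $\bar P[\phi(t-1)]\in\mathbb R^{n\times b}$: the $(i,d)$ entry is $p_{ij}/(\widehat w_{ij}(t)+L_{ij}(t))$ if $d=d^\ell_\ell((j,i))$ for some $j,\ell$ and $\phi_d(t-1)=1$, and $0$ otherwise. - $\bar P[L(t)]\in\mathbb R^{n\times n}$: the $(i,j)$ entry is $p_{ij}/(\widehat w_{ij}(t)+L_{ij}(t))$ if $L_{ij}(t)=1$, and $0$ otherwise. $$\widehat P(t)=\begin{bmatrix}I-\operatorname{diag}\big(\bar P[\phi(t-1)]\mathbf 1_b+\bar P[L(t)]\mathbf 1_n\big)+\bar P[L(t)] & \bar P[\phi(t-1)]\\ R(t)&C\end{bmatrix}.$$ The initial state $\widehat x(0)\in\mathbb R^{n+b}$ holds the initial values at the compute nodes and $0$ at the delay nodes. *)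

theory Defs
  imports "HOL-Probability.Probability" "Graph_Theory.Graph_Theory" "Jordan_Normal_Form.Matrix"
begin

hide_type (open) Finite_Cartesian_Product.vec
hide_const (open) Finite_Cartesian_Product.vec Determinants.det Finite_Cartesian_Product.mat
no_notation vec_nth (infixl \<open>$\<close> 90)

(* Nodes are numbered from 0: the compute nodes are 0, ..., n-1 and the delay nodes of the
   augmented system are n, ..., n+b-1.  The arc (j, i) means that j sends to i. *)

type_synonym edge = "nat \<times> nat"

(* (e, l, k) stands for the k-th node of the chain of length l belonging to the edge e. *)
type_synonym delay_node = "edge \<times> nat \<times> nat"

definition proper_edges :: "nat pair_pre_digraph \<Rightarrow> edge set" where
  "proper_edges G = {(j, i). (j, i) \<in> parcs G \<and> j \<noteq> i}"

definition row_stochastic :: "nat \<Rightarrow> real mat \<Rightarrow> bool" where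
  "row_stochastic n P \<longleftrightarrow> P \<in> carrier_mat n n
     \<and> (\<forall>i<n. \<forall>j<n. P $$ (i, j) \<ge> 0) \<and> (\<forall>i<n. (\<Sum>j<n. P $$ (i, j)) = 1)"

definition respects_graph :: "nat \<Rightarrow> real mat \<Rightarrow> nat pair_pre_digraph \<Rightarrow> bool" where
  "respects_graph n P G \<longleftrightarrow>
     (\<forall>i<n. \<forall>j<n. i \<noteq> j \<longrightarrow> (P $$ (i, j) > 0 \<longleftrightarrow> (j, i) \<in> parcs G))
     \<and> (\<forall>i<n. (i, i) \<in> parcs G \<and> P $$ (i, i) > 0)"

definition delay_nodes :: "nat pair_pre_digraph \<Rightarrow> nat \<Rightarrow> delay_node set" where
  "delay_nodes G B = {(e, l, k). e \<in> proper_edges G \<and> l \<in> {1..B} \<and> k \<in> {1..l}}"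

definition num_delay :: "nat pair_pre_digraph \<Rightarrow> nat \<Rightarrow> nat" where
  "num_delay G B = card (proper_edges G) * B * (B + 1) div 2"

lemma card_delay_nodes:
  assumes "finite (parcs G)"
  shows "finite (delay_nodes G B)" and "card (delay_nodes G B) = num_delay G B"
proof -
  have fin: "finite (proper_edges G)"
    by (rule finite_subset[OF _ assms]) (auto simp: proper_edges_def)
  have eq: "delay_nodes G B = proper_edges G \<times> (SIGMA l:{1..B}. {1..l})"
    by (auto simp: delay_nodes_def)
  show "finite (delay_nodes G B)"
    unfolding eq using fin by (intro finite_cartesian_product finite_SigmaI) auto
  have "card (SIGMA l:{1..B}. {1..l}) = (\<Sum>l=1..B. l)"
    by (subst card_SigmaI) auto
  also have "\<dots> = B * (B + 1) div 2"
    by (induction B) auto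
  finally have c: "card (SIGMA l:{1..B}. {1..l}) = B * (B + 1) div 2" .
  show "card (delay_nodes G B) = num_delay G B"
    unfolding eq card_cartesian_product c num_delay_def
    by (metis div_mult_swap even_mult_iff even_plus_one_iff mult.assoc)
qed

lemma ex_delay_enumeration:
  assumes "finite (parcs G)"
  shows "\<exists>D. bij_betw D {..<num_delay G B} (delay_nodes G B)"
  using ex_bij_betw_nat_finite[OF card_delay_nodes(1)[OF assms]] card_delay_nodes(2)[OF assms]
  by (simp add: atLeast0LessThan)

(* In the following, D numbers the delay nodes (D d is the delay node with index n + d), and
   tau e t is one realization of the delay of the message sent along e at iteration t >= 1. *)

abbreviation ones :: "nat \<Rightarrow> real vec" where
  "ones k \<equiv> vec k (\<lambda>_. 1)"

definition Lmat :: "nat pair_pre_digraph \<Rightarrow> nat \<Rightarrow> (edge \<Rightarrow> nat \<Rightarrow> nat) \<Rightarrow> nat \<Rightarrow> real mat" where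
  "Lmat G n \<tau> t = mat n n (\<lambda>(i, j). if (j, i) \<in> proper_edges G \<and> \<tau> (j, i) t = 0 then 1 else 0)"

definition Rmat :: "nat pair_pre_digraph \<Rightarrow> nat \<Rightarrow> nat \<Rightarrow> (nat \<Rightarrow> delay_node) \<Rightarrow>
    (edge \<Rightarrow> nat \<Rightarrow> nat) \<Rightarrow> nat \<Rightarrow> real mat" where
  "Rmat G n B D \<tau> t = mat (num_delay G B) n (\<lambda>(d, j).
     if \<exists>i l. (j, i) \<in> proper_edges G \<and> \<tau> (j, i) t = l \<and> l \<ge> 1 \<and> D d = ((j, i), l, 1)
     then 1 else 0)"

definition Cmat :: "nat pair_pre_digraph \<Rightarrow> nat \<Rightarrow> (nat \<Rightarrow> delay_node) \<Rightarrow> real mat" where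
  "Cmat G B D = mat (num_delay G B) (num_delay G B) (\<lambda>(d', d).
     if \<exists>e l k. D d = (e, l, k) \<and> D d' = (e, l, k + 1) then 1 else 0)"

fun phi :: "nat pair_pre_digraph \<Rightarrow> nat \<Rightarrow> nat \<Rightarrow> (nat \<Rightarrow> delay_node) \<Rightarrow>
    (edge \<Rightarrow> nat \<Rightarrow> nat) \<Rightarrow> nat \<Rightarrow> real vec" where
  "phi G n B D \<tau> 0 = 0\<^sub>v (num_delay G B)"
| "phi G n B D \<tau> (Suc t) =
     Rmat G n B D \<tau> (Suc t) *\<^sub>v ones n + Cmat G B D *\<^sub>v phi G n B D \<tau> t"

definition what :: "nat pair_pre_digraph \<Rightarrow> nat \<Rightarrow> nat \<Rightarrow> (nat \<Rightarrow> delay_node) \<Rightarrow>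
    (edge \<Rightarrow> nat \<Rightarrow> nat) \<Rightarrow> nat \<Rightarrow> nat \<Rightarrow> nat \<Rightarrow> nat" where
  "what G n B D \<tau> t i j = card {l \<in> {1..B}. \<exists>d<num_delay G B.
     D d = ((j, i), l, l) \<and> phi G n B D \<tau> (t - 1) $ d = 1}"

definition Pbar_phi :: "nat pair_pre_digraph \<Rightarrow> nat \<Rightarrow> nat \<Rightarrow> (nat \<Rightarrow> delay_node) \<Rightarrow> real mat \<Rightarrow>
    (edge \<Rightarrow> nat \<Rightarrow> nat) \<Rightarrow> nat \<Rightarrow> real mat" where
  "Pbar_phi G n B D P \<tau> t = mat n (num_delay G B) (\<lambda>(i, d). case D d of ((j, i'), l, k) \<Rightarrow>
     if i' = i \<and> k = l \<and> phi G n B D \<tau> (t - 1) $ d = 1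
     then P $$ (i, j) / (real (what G n B D \<tau> t i j) + Lmat G n \<tau> t $$ (i, j)) else 0)"

definition Pbar_L :: "nat pair_pre_digraph \<Rightarrow> nat \<Rightarrow> nat \<Rightarrow> (nat \<Rightarrow> delay_node) \<Rightarrow> real mat \<Rightarrow>
    (edge \<Rightarrow> nat \<Rightarrow> nat) \<Rightarrow> nat \<Rightarrow> real mat" where
  "Pbar_L G n B D P \<tau> t = mat n n (\<lambda>(i, j).
     if Lmat G n \<tau> t $$ (i, j) = 1
     then P $$ (i, j) / (real (what G n B D \<tau> t i j) + Lmat G n \<tau> t $$ (i, j)) else 0)"

definition Phat :: "nat pair_pre_digraph \<Rightarrow> nat \<Rightarrow> nat \<Rightarrow> (nat \<Rightarrow> delay_node) \<Rightarrow> real mat \<Rightarrow>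
    (edge \<Rightarrow> nat \<Rightarrow> nat) \<Rightarrow> nat \<Rightarrow> real mat" where
  "Phat G n B D P \<tau> t = four_block_mat
     (1\<^sub>m n
       - mat_diag n (\<lambda>i. (Pbar_phi G n B D P \<tau> t *\<^sub>v ones (num_delay G B)
                          + Pbar_L G n B D P \<tau> t *\<^sub>v ones n) $ i)
       + Pbar_L G n B D P \<tau> t)
     (Pbar_phi G n B D P \<tau> t)
     (Rmat G n B D \<tau> t)
     (Cmat G B D)"

(* u is the vector of the initial values of the compute nodes. *)
fun xhat :: "nat pair_pre_digraph \<Rightarrow> nat \<Rightarrow> nat \<Rightarrow> (nat \<Rightarrow> delay_node) \<Rightarrow> real mat \<Rightarrow>
    real vec \<Rightarrow> (edge \<Rightarrow> nat \<Rightarrow> nat) \<Rightarrow> nat \<Rightarrow> real vec" where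
  "xhat G n B D P u \<tau> 0 = u @\<^sub>v 0\<^sub>v (num_delay G B)"
| "xhat G n B D P u \<tau> (Suc t) = Phat G n B D P \<tau> (Suc t) *\<^sub>v xhat G n B D P u \<tau> t"

end

theory Submission
  imports Defs
begin

text \<open>
  The convergence holds for every realization whose delays are at most $B$; chance enters only
  through the null set where some delay exceeds $B$.  Unrolling the delay chains, the compute nodes
  satisfy \<open>x\<^sub>i(t+1) = (\<Sum>j<n. \<Sum>l\<le>B. w t i j l * x\<^sub>j(t-l))\<close> with convex weights, where self-weights
  and the weights of arriving messages are bounded below by a positive constant.  Hence the maximum
  and the minimum over the last $B+1$ iterations are monotone.  A node above the middle of this
  range pulls every node up by a fixed proportion of the range within a fixed time, because a message
  crosses each edge within $B+1$ iterations; a node below the middle acts symmetrically.  So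
  the range contracts geometrically, and the common limit lies between the extreme initial values.
\<close>

section \<open>Averaging with bounded delays\<close>

text \<open>
  \<open>w t i j l\<close> is the weight that \<open>i\<close> gives, at time \<open>Suc t\<close>, to the value that \<open>j\<close> had \<open>l\<close> steps
  before \<open>t\<close>.  For \<open>l > t\<close> the truncated subtraction \<open>t - l\<close> gives the initial value.
\<close>

locale delayed_averaging =
  fixes V :: "'a set" and E :: "('a \<times> 'a) set" and B :: nat and \<alpha> :: real
    and w :: "nat \<Rightarrow> 'a \<Rightarrow> 'a \<Rightarrow> nat \<Rightarrow> real" and y :: "nat \<Rightarrow> 'a \<Rightarrow> real"
  assumes finite_V: "finite V" and V_ne: "V \<noteq> {}"
    and edges: "E \<subseteq> V \<times> V" and connected: "V \<times> V \<subseteq> E\<^sup>*"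
    and alpha_pos: "\<alpha> > 0"
    and y_Suc: "i \<in> V \<Longrightarrow> y (Suc t) i = (\<Sum>j\<in>V. \<Sum>l\<le>B. w t i j l * y (t - l) j)"
    and w_nonneg: "i \<in> V \<Longrightarrow> j \<in> V \<Longrightarrow> l \<le> B \<Longrightarrow> w t i j l \<ge> 0"
    and w_sum: "i \<in> V \<Longrightarrow> (\<Sum>j\<in>V. \<Sum>l\<le>B. w t i j l) = 1"
    and w_self: "i \<in> V \<Longrightarrow> w t i i 0 \<ge> \<alpha>"
    and w_edge: "(j, i) \<in> E \<Longrightarrow> \<exists>l\<le>B. w (t + l) i j l \<ge> \<alpha>"
begin

section \<open>Lower bounds: persistence and spreading\<close>

lemma w_le_1:
  assumes "i \<in> V" "j \<in> V" "l \<le> B"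
  shows "w t i j l \<le> 1"
proof -
  have "w t i j l \<le> (\<Sum>l\<le>B. w t i j l)"
    using assms w_nonneg by (intro member_le_sum) auto
  also have "\<dots> \<le> (\<Sum>j\<in>V. \<Sum>l\<le>B. w t i j l)"
    using assms w_nonneg finite_V by (intro member_le_sum) (auto intro!: sum_nonneg)
  finally show ?thesis using w_sum[OF assms(1)] by simp
qed

lemma alpha_le_1: "\<alpha> \<le> 1"
proof -
  obtain i where "i \<in> V" using V_ne by blast
  with w_self[of i 0] w_le_1[of i i 0 0] show ?thesis by simp
qed

text \<open>After subtracting \<open>m\<close>, by \<open>w_sum\<close>, a sum of nonnegative terms
  remains, of which a single one is kept.\<close>

lemma step_ge:
  assumes lo: "\<And>l j. l \<le> B \<Longrightarrow> j \<in> V \<Longrightarrow> m \<le> y (t - l) j"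
    and i: "i \<in> V" and j: "j \<in> V" and l: "l \<le> B" and "\<alpha> \<le> w t i j l"
  shows "m + \<alpha> * (y (t - l) j - m) \<le> y (Suc t) i"
proof -
  have "\<alpha> * (y (t - l) j - m) \<le> w t i j l * (y (t - l) j - m)"
    using assms by (intro mult_right_mono) auto
  also have "\<dots> \<le> (\<Sum>l\<le>B. w t i j l * (y (t - l) j - m))"
    using assms w_nonneg by (intro member_le_sum) auto
  also have "\<dots> \<le> (\<Sum>j\<in>V. \<Sum>l\<le>B. w t i j l * (y (t - l) j - m))"
    using assms w_nonneg finite_V
    by (intro member_le_sum[of j V "\<lambda>j. \<Sum>l\<le>B. w t i j l * (y (t - l) j - m)"])
      (auto intro!: sum_nonneg)
  also have "\<dots> = y (Suc t) i - (\<Sum>j\<in>V. \<Sum>l\<le>B. w t i j l) * m"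
    by (simp add: y_Suc i right_diff_distrib sum_subtractf sum_distrib_right)
  finally show ?thesis using w_sum[OF i, of t] by simp
qed

text \<open>Each new value is a convex combination of values in the previous window, so a bound on
  one window passes to all later ones.\<close>

lemma ge_forever:
  assumes lo: "\<And>l j. l \<le> B \<Longrightarrow> j \<in> V \<Longrightarrow> m \<le> y (t - l) j"
    and "l \<le> B" "j \<in> V"
  shows "m \<le> y (t + s - l) j"
  using assms(2,3)
proof (induction s arbitrary: l j)
  case (Suc s)
  have "m \<le> y (Suc (t + s)) j"
  proof -
    have "m + \<alpha> * (y (t + s - 0) j - m) \<le> y (Suc (t + s)) j"
      using Suc w_self by (intro step_ge) auto
    moreover have "0 \<le> \<alpha> * (y (t + s - 0) j - m)"
      using Suc.IH[of 0 j] Suc.prems alpha_pos by auto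
    ultimately show ?thesis by linarith
  qed
  \<comment> \<open>Lag 0 is the new value just bounded; any other lag is one less in the previous
    window.\<close>
  then show ?case
    using Suc by (cases l) auto
qed (use lo in auto)

text \<open>The self-weight preserves at least the fraction \<alpha> of an excess over
  \<open>m\<close> in each step.\<close>

lemma self_decay:
  assumes lo: "\<And>l j. l \<le> B \<Longrightarrow> j \<in> V \<Longrightarrow> m \<le> y (t - l) j"
    and j: "j \<in> V" and c: "m + c \<le> y (t + s) j"
  shows "m + \<alpha> ^ r * c \<le> y (t + s + r) j"
proof (induction r)
  case (Suc r)
  have "m + \<alpha> ^ Suc r * c = m + \<alpha> * (m + \<alpha> ^ r * c - m)"
    by simp
  also have "\<dots> \<le> m + \<alpha> * (y (t + s + r - 0) j - m)"
    using Suc alpha_pos by (intro add_left_mono mult_left_mono) auto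
  also have "\<dots> \<le> y (Suc (t + s + r)) j"
    using j w_self ge_forever[OF lo, of _ _ "s + r"] by (intro step_ge) (auto simp: add.assoc)
  finally show ?case by simp
qed (use c in auto)

text \<open>An excess crosses one edge in at most \<open>B + 1\<close> steps. Since the exponent is
  the elapsed time \<open>s\<close>, whatever the path, spare time is absorbed by
  \<open>self_decay\<close> and the induction over hops closes.\<close>

lemma spread:
  assumes lo: "\<And>l j. l \<le> B \<Longrightarrow> j \<in> V \<Longrightarrow> m \<le> y (t - l) j"
    and c: "c \<ge> 0" "m + c \<le> y t k" and k: "k \<in> V"
    and "(k, i) \<in> E ^^ h" "s \<ge> h * (B + 1)"
  shows "m + \<alpha> ^ s * c \<le> y (t + s) i"
  using assms(5,6)
proof (induction h arbitrary: i s)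
  case 0
  then show ?case using self_decay[OF lo k, of c 0 s] c by simp
next
  case (Suc h)
  from Suc.prems obtain j where j: "(k, j) \<in> E ^^ h" "(j, i) \<in> E"
    by auto
  then have V: "j \<in> V" "i \<in> V" using edges by auto
  \<comment> \<open>By time \<open>t + r\<close> the excess has reached \<open>j\<close>. The value
    of \<open>j\<close> at that time is read by \<open>i\<close> with age \<open>l\<close>, in the
    step from \<open>t + r + l\<close>, so it shows at \<open>i\<close> one step later.\<close>
  define r where "r = h * (B + 1)"
  obtain l where l: "l \<le> B" "\<alpha> \<le> w (t + r + l) i j l"
    using w_edge[OF j(2)] by blast
  \<comment> \<open>The edge costs a single factor \<alpha>; the exponent is raised to the elapsed
    time because \<open>\<alpha> \<le> 1\<close>.\<close>
  have "m + \<alpha> ^ (r + l + 1) * c \<le> m + \<alpha> ^ (r + 1) * c"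
    using c alpha_pos alpha_le_1 by (intro add_left_mono mult_right_mono power_decreasing) auto
  also have "\<dots> = m + \<alpha> * (m + \<alpha> ^ r * c - m)"
    by simp
  also have "\<dots> \<le> m + \<alpha> * (y (t + r + l - l) j - m)"
    using Suc.IH[OF j(1), of r] alpha_pos by (intro add_left_mono mult_left_mono) (auto simp: r_def)
  also have "\<dots> \<le> y (Suc (t + r + l)) i"
    using V l ge_forever[OF lo, of _ _ "r + l"] by (intro step_ge) (auto simp: add.assoc)
  also have "Suc (t + r + l) = t + (r + l + 1)"
    by simp
  finally have "m + \<alpha> ^ (r + l + 1) * c \<le> y (t + (r + l + 1)) i" .
  from self_decay[OF lo V(2) this, of "s - (r + l + 1)"]
  have "m + \<alpha> ^ (s - (r + l + 1)) * (\<alpha> ^ (r + l + 1) * c)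
    \<le> y (t + (r + l + 1) + (s - (r + l + 1))) i" .
  moreover have le: "r + l + 1 \<le> s"
    using Suc.prems l(1) by (simp add: r_def)
  then have "\<alpha> ^ s = \<alpha> ^ (s - (r + l + 1)) * \<alpha> ^ (r + l + 1)"
    by (metis le_add_diff_inverse2 power_add)
  moreover have "t + (r + l + 1) + (s - (r + l + 1)) = t + s"
    using le by simp
  ultimately show ?case by (simp add: mult.assoc)
qed

section \<open>Contraction of the range over the last B + 1 times\<close>

lemma ex_hop_bound: "\<exists>N. \<forall>k\<in>V. \<forall>i\<in>V. \<exists>h\<le>N. (k, i) \<in> E ^^ h"
proof -
  have "\<forall>p\<in>V \<times> V. \<exists>h. p \<in> E ^^ h"
    using connected by (auto simp: rtrancl_power)
  then obtain H where H: "\<forall>p\<in>V \<times> V. p \<in> E ^^ H p"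
    by metis
  have "\<forall>k\<in>V. \<forall>i\<in>V. H (k, i) \<le> Max (H ` (V \<times> V))"
    using finite_V by (auto intro!: Max_ge)
  with H show ?thesis by blast
qed

text \<open>All the values that the next update can read. Lags reaching before time 0 repeat the
  initial values, so \<open>window 0\<close> holds exactly these.\<close>

definition window :: "nat \<Rightarrow> real set" where
  "window t = (\<lambda>(l, j). y (t - l) j) ` ({..B} \<times> V)"

lemma finite_window: "finite (window t)" and window_ne: "window t \<noteq> {}"
  using finite_V V_ne by (auto simp: window_def)

lemma Min_window_le: "l \<le> B \<Longrightarrow> j \<in> V \<Longrightarrow> Min (window t) \<le> y (t - l) j"
  using finite_window by (auto simp: window_def intro!: Min_le)

lemma le_Max_window: "l \<le> B \<Longrightarrow> j \<in> V \<Longrightarrow> y (t - l) j \<le> Max (window t)"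
  using finite_window by (auto simp: window_def intro!: Max_ge)

lemma le_Min_window: "(\<And>l j. l \<le> B \<Longrightarrow> j \<in> V \<Longrightarrow> m \<le> y (t - l) j) \<Longrightarrow> m \<le> Min (window t)"
  using finite_window window_ne by (auto simp: window_def)

lemma incseq_Min_window: "incseq (\<lambda>t. Min (window t))"
  using ge_forever[OF Min_window_le, where s = 1]
  by (intro incseq_SucI le_Min_window) auto

lemma Min_window_gain:
  assumes N: "\<forall>k\<in>V. \<forall>i\<in>V. \<exists>h\<le>N. (k, i) \<in> E ^^ h"
    and T: "T = N * (B + 1) + B"
    and k: "k \<in> V" and c: "c \<ge> 0" "Min (window t) + c \<le> y t k"
  shows "Min (window t) + \<alpha> ^ T * c \<le> Min (window (t + T))"
proof (rule le_Min_window)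
  fix l i assume l: "l \<le> B" and i: "i \<in> V"
  obtain h where h: "h \<le> N" "(k, i) \<in> E ^^ h"
    using N k i by blast
  have "h * (B + 1) \<le> N * (B + 1)"
    using h by (intro mult_right_mono) auto
  \<comment> \<open>\<open>T\<close> exceeds \<open>N * (B + 1)\<close> by \<open>B\<close>, so even
    the oldest time of the new window, \<open>t + T - B\<close>, is late enough for
    \<open>spread\<close>.\<close>
  then have "Min (window t) + \<alpha> ^ (T - l) * c \<le> y (t + (T - l)) i"
    using l by (intro spread[OF Min_window_le c k h(2)]) (auto simp: T)
  moreover have "\<alpha> ^ T * c \<le> \<alpha> ^ (T - l) * c"
    using c alpha_pos alpha_le_1 by (intro mult_right_mono power_decreasing) auto
  ultimately show "Min (window t) + \<alpha> ^ T * c \<le> y (t + T - l) i"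
    using l by (simp add: T)
qed

text \<open>Negation exchanges minima and maxima, so each bound from below also yields one from
  above.\<close>

lemma uminus_averaging: "delayed_averaging V E B \<alpha> w (\<lambda>t i. - y t i)"
  using finite_V V_ne edges connected alpha_pos w_nonneg w_sum w_self w_edge
  by unfold_locales (auto simp: y_Suc sum_negf)

interpretation neg: delayed_averaging V E B \<alpha> w "\<lambda>t i. - y t i"
  by (rule uminus_averaging)

lemma neg_window: "neg.window t = uminus ` window t"
  unfolding window_def neg.window_def by (auto simp: image_image case_prod_unfold)

lemma Min_neg_window: "Min (neg.window t) = - Max (window t)"
  unfolding neg_window using finite_window window_ne
  by (intro Min_eqI) auto

lemma decseq_Max_window: "decseq (\<lambda>t. Max (window t))"
  using neg.incseq_Min_window by (auto simp: Min_neg_window incseq_def decseq_def)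

lemma gap_contraction:
  "\<exists>\<delta>>0. \<exists>T. \<forall>t. Max (window (t + T)) - Min (window (t + T))
     \<le> (1 - \<delta>) * (Max (window t) - Min (window t))"
proof -
  obtain N where N: "\<forall>k\<in>V. \<forall>i\<in>V. \<exists>h\<le>N. (k, i) \<in> E ^^ h"
    using ex_hop_bound by blast
  define T where "T = N * (B + 1) + B"
  obtain k where k: "k \<in> V" using V_ne by blast
  have "Max (window (t + T)) - Min (window (t + T))
     \<le> (1 - \<alpha> ^ T / 2) * (Max (window t) - Min (window t))" for t
  proof -
    \<comment> \<open>Half the gap is chosen for \<open>c\<close> so that any node \<open>k\<close>
      lies at least \<open>c\<close> above the minimum or at least \<open>c\<close> below the
      maximum. In the first case the minimum rises by \<open>\<alpha> ^ T * c\<close>, in the second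
      the maximum falls by as much; the other extremum is monotone.\<close>
    define m M c where "m = Min (window t)" and "M = Max (window t)" and "c = (M - m) / 2"
    have mono: "m \<le> Min (window (t + T))" "Max (window (t + T)) \<le> M"
      unfolding m_def M_def
      using incseq_Min_window decseq_Max_window by (auto simp: incseq_def decseq_def)
    have "m \<le> M"
      using Min_window_le[of 0 k t] le_Max_window[of 0 k t] k by (auto simp: m_def M_def)
    then have c: "c \<ge> 0" by (simp add: c_def)
    have "m + c \<le> y t k \<or> - M + c \<le> - y t k"
      by (auto simp: c_def field_simps)
    then have "m + \<alpha> ^ T * c \<le> Min (window (t + T)) \<or> Max (window (t + T)) \<le> M - \<alpha> ^ T * c"
      using Min_window_gain[OF N T_def k c, of t] neg.Min_window_gain[OF N T_def k c, of t]
      by (auto simp: Min_neg_window m_def M_def)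
    with mono have "Max (window (t + T)) - Min (window (t + T)) \<le> (M - m) - \<alpha> ^ T * c"
      using c alpha_pos by auto
    also have "\<dots> = (1 - \<alpha> ^ T / 2) * (M - m)"
      by (simp add: c_def algebra_simps)
    finally show ?thesis by (simp add: m_def M_def)
  qed
  with alpha_pos show ?thesis by (intro exI[of _ "\<alpha> ^ T / 2"]) auto
qed

lemma consensus:
  "\<exists>v. (\<forall>i\<in>V. (\<lambda>t. y t i) \<longlonglongrightarrow> v) \<and> Min (y 0 ` V) \<le> v \<and> v \<le> Max (y 0 ` V)"
proof -
  have le: "Min (window t) \<le> Max (window t)" for t
    using finite_window window_ne by (meson Max_in Min_le)
  have le0: "Min (window t) \<le> Max (window 0)" "Min (window 0) \<le> Max (window t)" for t
    using le[of t] incseqD[OF incseq_Min_window le0, of t] decseqD[OF decseq_Max_window le0, of t]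
    by linarith+
  obtain m where m: "(\<lambda>t. Min (window t)) \<longlonglongrightarrow> m" "\<forall>t. Min (window t) \<le> m"
    using incseq_convergent[OF incseq_Min_window, of "Max (window 0)"] le0 by blast
  obtain M where M: "(\<lambda>t. Max (window t)) \<longlonglongrightarrow> M" "\<forall>t. M \<le> Max (window t)"
    using decseq_convergent[OF decseq_Max_window, of "Min (window 0)"] le0 by blast
  obtain \<delta> T where \<delta>: "\<delta> > 0" "\<forall>t. Max (window (t + T)) - Min (window (t + T))
     \<le> (1 - \<delta>) * (Max (window t) - Min (window t))"
    using gap_contraction by blast
  \<comment> \<open>The contraction inequality survives in the limit and forces both limits to
    agree.\<close>
  have "M - m \<le> (1 - \<delta>) * (M - m)"
  proof (rule LIMSEQ_le)
    show "(\<lambda>t. Max (window (t + T)) - Min (window (t + T))) \<longlonglongrightarrow> M - m"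
      by (intro tendsto_diff LIMSEQ_ignore_initial_segment m M)
    show "(\<lambda>t. (1 - \<delta>) * (Max (window t) - Min (window t))) \<longlonglongrightarrow> (1 - \<delta>) * (M - m)"
      by (intro tendsto_intros m M)
  qed (use \<delta> in auto)
  then have "\<delta> * (M - m) \<le> 0" by (simp add: algebra_simps)
  then have "M \<le> m" using \<delta>(1) by (simp add: mult_le_0_iff)
  moreover have "m \<le> M" using le by (intro LIMSEQ_le[OF m(1) M(1)]) auto
  ultimately have "M = m" by simp
  have "(\<lambda>t. y t i) \<longlonglongrightarrow> m" if "i \<in> V" for i
    using m(1) M(1)[unfolded \<open>M = m\<close>]
    by (rule real_tendsto_sandwich[rotated 2])
      (use Min_window_le[of 0 i] le_Max_window[of 0 i] that in auto)
  moreover have "window 0 = y 0 ` V"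
    by (force simp: window_def)
  ultimately show ?thesis
    using m(2)[rule_format, of 0] M(2)[rule_format, of 0] \<open>M = m\<close> by (intro exI[of _ m]) auto
qed

end

section \<open>The random delay model\<close>

locale delay_system =
  fixes G :: "nat pair_pre_digraph" and n B :: nat and P :: "real mat"
    and D :: "nat \<Rightarrow> delay_node" and u :: "real vec" and \<tau> :: "edge \<Rightarrow> nat \<Rightarrow> nat"
  assumes fin_digraph: "pair_fin_digraph G" and verts: "pverts G = {..<n}"
    and strong: "strongly_connected G"
    and stochastic: "row_stochastic n P" and respects: "respects_graph n P G"
    and D_bij: "bij_betw D {..<num_delay G B} (delay_nodes G B)"
    and u_carrier: "u \<in> carrier_vec n"
    and delay_le: "e \<in> proper_edges G \<Longrightarrow> t \<ge> 1 \<Longrightarrow> \<tau> e t \<le> B"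
begin

abbreviation "b \<equiv> num_delay G B"
abbreviation "R \<equiv> Rmat G n B D \<tau>"
abbreviation "C \<equiv> Cmat G B D"
abbreviation "x \<equiv> xhat G n B D P u \<tau>"
abbreviation "\<phi> \<equiv> phi G n B D \<tau>"

lemma proper_lt: "(j, i) \<in> proper_edges G \<Longrightarrow> j < n \<and> i < n \<and> j \<noteq> i"
proof -
  interpret pair_fin_digraph G by (rule fin_digraph)
  show "(j, i) \<in> proper_edges G \<Longrightarrow> j < n \<and> i < n \<and> j \<noteq> i"
    using in_arcsD1[of j i] in_arcsD2[of j i] verts by (auto simp: proper_edges_def)
qed

lemma D_in: "d < b \<Longrightarrow> D d \<in> delay_nodes G B"
  using D_bij by (auto simp: bij_betw_def)

lemma D_eq_iff: "d < b \<Longrightarrow> d' < b \<Longrightarrow> D d = D d' \<longleftrightarrow> d = d'"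
  using D_bij by (auto simp: bij_betw_def inj_on_def)

lemma D_surj: "p \<in> delay_nodes G B \<Longrightarrow> \<exists>d<b. D d = p"
  using D_bij by (force simp: bij_betw_def)

section \<open>Delay chains as shift registers\<close>

lemma C_mult_first:
  assumes "z \<in> carrier_vec b" "d < b" "D d = (e, l, 1)"
  shows "(C *\<^sub>v z) $ d = 0"
proof -
  have "C $$ (d, d') = 0" if "d' < b" for d'
    using assms that D_in[OF that] by (auto simp: Cmat_def delay_nodes_def)
  then show ?thesis
    using assms by (auto simp: Cmat_def scalar_prod_def intro!: sum.neutral)
qed

lemma C_mult_next:
  assumes "z \<in> carrier_vec b" "d < b" "d' < b" "D d = (e, l, k)" "D d' = (e, l, Suc k)"
  shows "(C *\<^sub>v z) $ d' = z $ d"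
proof -
  have "C $$ (d', a) = (if a = d then 1 else 0)" if "a < b" for a
    using assms that D_eq_iff[OF that \<open>d < b\<close>] by (auto simp: Cmat_def)
  then have "row C d' $ a * z $ a = (if a = d then z $ a else 0)" if "a < b" for a
    using assms that by (auto simp: Cmat_def)
  then have "row C d' \<bullet> z = (\<Sum>a<b. if a = d then z $ a else 0)"
    using assms by (auto simp: scalar_prod_def lessThan_atLeast0 intro!: sum.cong)
  then show ?thesis
    using assms by (simp add: Cmat_def)
qed

lemma R_mult:
  assumes "z \<in> carrier_vec n" "d < b" and D: "D d = ((j, i), l, k)"
  shows "(R t *\<^sub>v z) $ d = (if k = 1 \<and> \<tau> (j, i) t = l then z $ j else 0)"
proof -
  have p: "(j, i) \<in> proper_edges G" "l \<ge> 1"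
    using D_in[OF assms(2)] D by (auto simp: delay_nodes_def)
  have "row (R t) d $ a * z $ a = (if a = j then if k = 1 \<and> \<tau> (j, i) t = l then z $ j else 0 else 0)"
    if "a < n" for a
    using assms that p by (auto simp: Rmat_def)
  then have "row (R t) d \<bullet> z =
      (\<Sum>a<n. if a = j then if k = 1 \<and> \<tau> (j, i) t = l then z $ j else 0 else 0)"
    using assms by (auto simp: scalar_prod_def lessThan_atLeast0 intro!: sum.cong)
  then show ?thesis
    using assms proper_lt[OF p(1)] by (simp add: Rmat_def)
qed

text \<open>What the \<open>k\<close>-th node of a chain holds at time \<open>t\<close> entered
  through \<open>R\<close> at iteration \<open>Suc t - k\<close>, whose input is
  \<open>a (t - k)\<close>. The input is left general to cover both the occupancy
  \<open>\<phi>\<close> (all ones) and the transmitted states.\<close>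

lemma delay_line:
  assumes z0: "z 0 = 0\<^sub>v b"
    and z_Suc: "\<And>t. z (Suc t) = R (Suc t) *\<^sub>v a t + C *\<^sub>v z t"
    and a: "\<And>t. a t \<in> carrier_vec n"
    and "d < b" "D d = ((j, i), l, k)"
  shows "z t $ d = (if k \<le> t \<and> \<tau> (j, i) (Suc t - k) = l then a (t - k) $ j else 0)"
  using assms(4,5)
proof (induction t arbitrary: d k)
  case 0
  then show ?case using D_in[of d] by (auto simp: z0 delay_nodes_def)
next
  case (Suc t)
  have z: "z t \<in> carrier_vec b"
    by (cases t) (auto simp: z0 z_Suc Cmat_def intro!: carrier_vecI)
  have eq: "z (Suc t) $ d = (R (Suc t) *\<^sub>v a t) $ d + (C *\<^sub>v z t) $ d"
    using Suc.prems by (simp add: z_Suc Cmat_def Rmat_def)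
  show ?case
  \<comment> \<open>The first node of a chain is fed by \<open>R\<close> only, every later one only
    by its predecessor through \<open>C\<close>.\<close>
  proof (cases "k = 1")
    case True
    then show ?thesis
      using C_mult_first[OF z Suc.prems(1)] R_mult[OF a Suc.prems] Suc.prems by (simp add: eq)
  next
    case False
    then obtain k' where k': "k = Suc k'" "((j, i), l, k') \<in> delay_nodes G B"
      using D_in[of d] Suc.prems by (cases k) (auto simp: delay_nodes_def)
    then obtain d' where d': "d' < b" "D d' = ((j, i), l, k')"
      using D_surj by blast
    have "(C *\<^sub>v z t) $ d = z t $ d'"
      using C_mult_next[OF z d'(1) Suc.prems(1) d'(2)] k' Suc.prems(2) by simp
    then show ?thesis
      using R_mult[OF a Suc.prems] False Suc.IH[OF d'] by (simp add: eq k'(1))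
  qed
qed

section \<open>Arriving messages and their shares\<close>

lemma phi_eq:
  assumes "d < b" "D d = ((j, i), l, k)"
  shows "\<phi> t $ d = (if k \<le> t \<and> \<tau> (j, i) (Suc t - k) = l then 1 else 0)"
proof -
  have "j < n"
    using D_in[OF assms(1)] assms(2) proper_lt by (auto simp: delay_nodes_def)
  then show ?thesis
    using delay_line[of \<phi> "\<lambda>_. ones n", OF _ _ _ assms, of t] by simp
qed

text \<open>
  The ages \<open>l\<close> of the messages from \<open>j\<close> that \<open>i\<close> reads in the step from \<open>t\<close> to \<open>Suc t\<close>.  The age 0 is
  an undelayed message, which the matrices treat separately through \<open>Lmat\<close>.
\<close>

definition arrivals :: "nat \<Rightarrow> nat \<Rightarrow> nat \<Rightarrow> nat set" where
  "arrivals t j i = {l. l \<le> B \<and> (j, i) \<in> proper_edges G \<and> l \<le> t \<and> \<tau> (j, i) (Suc t - l) = l}"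

abbreviation "share t i j \<equiv> P $$ (i, j) / real (card (arrivals t j i))"

lemma finite_arrivals [simp]: "finite (arrivals t j i)"
  by (rule finite_subset[of _ "{..B}"]) (auto simp: arrivals_def)

lemma card_arrivals_le: "card (arrivals t j i) \<le> B + 1"
  using card_mono[of "{..B}" "arrivals t j i"] by (auto simp: arrivals_def)

text \<open>The last node of the chain of length \<open>l\<close> is occupied exactly when a message
  of age \<open>l\<close> arrives; age 0 bypasses the chains.\<close>

lemma what_eq: "what G n B D \<tau> (Suc t) i j = card (arrivals t j i - {0})"
proof -
  have "(\<exists>d<b. D d = ((j, i), l, l) \<and> \<phi> t $ d = 1) \<longleftrightarrow>
      (j, i) \<in> proper_edges G \<and> l \<le> t \<and> \<tau> (j, i) (Suc t - l) = l" (is "?L \<longleftrightarrow> ?R")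
    if "l \<in> {1..B}" for l
  proof
    assume ?L
    then obtain d where d: "d < b" "D d = ((j, i), l, l)" "\<phi> t $ d = 1" by blast
    with D_in[OF d(1)] phi_eq[OF d(1,2), of t] show ?R
      by (auto simp: delay_nodes_def split: if_splits)
  next
    assume ?R
    with that have "((j, i), l, l) \<in> delay_nodes G B" by (auto simp: delay_nodes_def)
    then obtain d where d: "d < b" "D d = ((j, i), l, l)" using D_surj by blast
    with phi_eq[OF d, of t] \<open>?R\<close> show ?L by auto
  qed
  then have "{l \<in> {1..B}. \<exists>d<b. D d = ((j, i), l, l) \<and> \<phi> t $ d = 1} = arrivals t j i - {0}"
    by (auto simp: arrivals_def)
  then show ?thesis by (simp add: what_def)
qed

lemma Lmat_eq: "i < n \<Longrightarrow> j < n \<Longrightarrow>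
    Lmat G n \<tau> (Suc t) $$ (i, j) = (if 0 \<in> arrivals t j i then 1 else 0)"
  by (auto simp: Lmat_def arrivals_def)

text \<open>The denominators in \<open>Phat\<close> thus split \<open>P $$ (i, j)\<close> equally
  among the messages from \<open>j\<close> that arrive together.\<close>

lemma num_arrivals: "i < n \<Longrightarrow> j < n \<Longrightarrow>
    real (what G n B D \<tau> (Suc t) i j) + Lmat G n \<tau> (Suc t) $$ (i, j) = card (arrivals t j i)"
  using card.remove[of "arrivals t j i" 0] by (auto simp: what_eq Lmat_eq)

text \<open>Only last nodes of chains into \<open>i\<close> contribute, and sender and age index
  them. \<open>f\<close> describes \<open>z\<close> there, so that the lemma serves both the row
  sums (\<open>ones b\<close>) and the stored values.\<close>

lemma Pbar_phi_mult:
  assumes i: "i < n" and z: "z \<in> carrier_vec b"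
    and f: "\<And>d j l. d < b \<Longrightarrow> D d = ((j, i), l, l) \<Longrightarrow> l \<in> arrivals t j i \<Longrightarrow> z $ d = f j l"
  shows "(Pbar_phi G n B D P \<tau> (Suc t) *\<^sub>v z) $ i =
    (\<Sum>j<n. \<Sum>l\<in>arrivals t j i - {0}. share t i j * f j l)"
proof -
  let ?S = "SIGMA j:{..<n}. arrivals t j i - {0}"
  \<comment> \<open>\<open>?h (j, l)\<close> is the last node of the chain of length
    \<open>l\<close> from \<open>j\<close> to \<open>i\<close>; \<open>g\<close> vanishes at all
    delay nodes outside the image of \<open>?S\<close>.\<close>
  let ?h = "\<lambda>(j, l). ((j, i), l, l)"
  define g where "g = (\<lambda>((j, i'), l, k). if i' = i \<and> k = l \<and> l \<in> arrivals t j i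
    then share t i j * f j l else 0)"
  have "row (Pbar_phi G n B D P \<tau> (Suc t)) i $ d * z $ d = g (D d)" if d: "d < b" for d
  proof -
    obtain j i' l k where D: "D d = ((j, i'), l, k)" by (cases "D d") auto
    have p: "(j, i') \<in> proper_edges G" "l \<in> {1..B}" "k \<in> {1..l}"
      using D_in[OF d] D by (auto simp: delay_nodes_def)
    have "(i' = i \<and> k = l \<and> \<phi> t $ d = 1) = (i' = i \<and> k = l \<and> l \<in> arrivals t j i)"
      using p by (auto simp: phi_eq[OF d D] arrivals_def)
    then show ?thesis
      using d i D f[OF d, of j l] proper_lt[OF p(1)]
      by (auto simp: Pbar_phi_def g_def num_arrivals)
  qed
  then have "(Pbar_phi G n B D P \<tau> (Suc t) *\<^sub>v z) $ i = (\<Sum>d<b. g (D d))"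
    using i z by (auto simp: Pbar_phi_def scalar_prod_def lessThan_atLeast0 intro!: sum.cong)
  also have "\<dots> = (\<Sum>p\<in>delay_nodes G B. g p)"
    by (rule sum.reindex_bij_betw[OF D_bij])
  also have "\<dots> = (\<Sum>p\<in>?h ` ?S. g p)"
  proof (rule sum.mono_neutral_right)
    show "finite (delay_nodes G B)"
      by (intro card_delay_nodes pair_fin_digraph.pair_finite_arcs[OF fin_digraph])
    show "?h ` ?S \<subseteq> delay_nodes G B"
      by (auto simp: delay_nodes_def arrivals_def)
    show "\<forall>p\<in>delay_nodes G B - ?h ` ?S. g p = 0"
    proof
      fix p assume p: "p \<in> delay_nodes G B - ?h ` ?S"
      obtain j i' l k where eq: "p = ((j, i'), l, k)" by (cases p) auto
      have "j < n" "l \<noteq> 0" using p by (auto simp: eq delay_nodes_def dest: proper_lt)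
      then have "g p \<noteq> 0 \<Longrightarrow> p = ?h (j, l) \<and> (j, l) \<in> ?S"
        by (auto simp: eq g_def split: if_splits)
      with p show "g p = 0" by blast
    qed
  qed
  also have "\<dots> = (\<Sum>(j, l)\<in>?S. share t i j * f j l)"
    by (subst sum.reindex) (auto simp: inj_on_def g_def intro!: sum.cong)
  also have "\<dots> = (\<Sum>j<n. \<Sum>l\<in>arrivals t j i - {0}. share t i j * f j l)"
    by (simp add: sum.Sigma)
  finally show ?thesis .
qed

text \<open>The inner sum has at most one term; this form joins with the sum over positive ages
  through \<open>sum_arrivals_split\<close>.\<close>

lemma Pbar_L_mult:
  assumes i: "i < n" and z: "z \<in> carrier_vec n"
  shows "(Pbar_L G n B D P \<tau> (Suc t) *\<^sub>v z) $ i =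
    (\<Sum>j<n. \<Sum>l\<in>arrivals t j i \<inter> {0}. share t i j * z $ j)"
proof -
  have "row (Pbar_L G n B D P \<tau> (Suc t)) i $ j * z $ j =
      (\<Sum>l\<in>arrivals t j i \<inter> {0}. share t i j * z $ j)" if "j < n" for j
    using i that num_arrivals[OF i that, of t] by (auto simp: Pbar_L_def Lmat_eq)
  then show ?thesis
    using i z by (auto simp: Pbar_L_def scalar_prod_def lessThan_atLeast0 intro!: sum.cong)
qed

lemma sum_arrivals_split:
  fixes f :: "nat \<Rightarrow> real"
  shows "(\<Sum>l\<in>arrivals t j i - {0}. f l) + (\<Sum>l\<in>arrivals t j i \<inter> {0}. f l) =
    (\<Sum>l\<in>arrivals t j i. f l)"
  using sum.Int_Diff[of "arrivals t j i" f "{0}"] by simp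

text \<open>The share is constant in \<open>l\<close>, so this is the total of \<open>P $$ (i, j)\<close> over the \<open>j\<close> heard from.\<close>

definition received :: "nat \<Rightarrow> nat \<Rightarrow> real" where
  "received t i = (\<Sum>j<n. \<Sum>l\<in>arrivals t j i. share t i j)"

section \<open>Elimination of the delay nodes\<close>

lemma received_eq: "i < n \<Longrightarrow>
  (Pbar_phi G n B D P \<tau> (Suc t) *\<^sub>v ones b + Pbar_L G n B D P \<tau> (Suc t) *\<^sub>v ones n) $ i = received t i"
  using Pbar_phi_mult[of i "ones b" t "\<lambda>_ _. 1"] Pbar_L_mult[of i "ones n" t]
  by (simp add: received_def Pbar_L_def sum.distrib[symmetric] sum_arrivals_split del: sum_constant)

text \<open>The upper left block of \<open>Phat\<close>.\<close>

definition W :: "nat \<Rightarrow> real mat" where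
  "W t = 1\<^sub>m n - mat_diag n (\<lambda>i. (Pbar_phi G n B D P \<tau> t *\<^sub>v ones b
      + Pbar_L G n B D P \<tau> t *\<^sub>v ones n) $ i) + Pbar_L G n B D P \<tau> t"

lemma W_mult:
  assumes i: "i < n" and z: "z \<in> carrier_vec n"
  shows "(W (Suc t) *\<^sub>v z) $ i = (1 - received t i) * z $ i + (Pbar_L G n B D P \<tau> (Suc t) *\<^sub>v z) $ i"
proof -
  have "row (W (Suc t)) i $ j * z $ j = (if j = i then (1 - received t i) * z $ i else 0)
      + row (Pbar_L G n B D P \<tau> (Suc t)) i $ j * z $ j" if "j < n" for j
    using i that received_eq[OF i]
    by (auto simp: W_def Pbar_L_def mat_diag_def algebra_simps)
  then have "(\<Sum>j<n. row (W (Suc t)) i $ j * z $ j) = (1 - received t i) * z $ i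
      + (\<Sum>j<n. row (Pbar_L G n B D P \<tau> (Suc t)) i $ j * z $ j)"
    using i by (simp add: sum.distrib)
  then show ?thesis
    using i z by (simp add: W_def Pbar_L_def scalar_prod_def lessThan_atLeast0 mat_diag_def)
qed

lemma x_carrier: "x t \<in> carrier_vec (n + b)"
  using u_carrier
  by (cases t) (auto simp: Phat_def Cmat_def mat_diag_def Pbar_L_def Rmat_def intro!: carrier_vecI)

text \<open>The two block rows of \<open>Phat\<close>; the second has the shape that
  \<open>delay_line\<close> requires.\<close>

lemma x_Suc:
  defines "a \<equiv> \<lambda>t. vec_first (x t) n" and "z \<equiv> \<lambda>t. vec_last (x t) b"
  shows "a (Suc t) = W (Suc t) *\<^sub>v a t + Pbar_phi G n B D P \<tau> (Suc t) *\<^sub>v z t"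
    and "z (Suc t) = R (Suc t) *\<^sub>v a t + C *\<^sub>v z t"
proof -
  have "x (Suc t) = Phat G n B D P \<tau> (Suc t) *\<^sub>v (a t @\<^sub>v z t)"
    using x_carrier[of t] by (simp add: a_def z_def)
  also have "\<dots> = (W (Suc t) *\<^sub>v a t + Pbar_phi G n B D P \<tau> (Suc t) *\<^sub>v z t)
      @\<^sub>v (R (Suc t) *\<^sub>v a t + C *\<^sub>v z t)"
    unfolding Phat_def W_def[symmetric]
    by (rule four_block_mat_mult_vec[where ?nr1.0 = n and ?nr2.0 = b])
      (auto simp: W_def Pbar_L_def Pbar_phi_def Rmat_def Cmat_def a_def z_def mat_diag_def)
  finally have x: "x (Suc t) = \<dots>" .
  have dims: "dim_vec (W (Suc t) *\<^sub>v a t + Pbar_phi G n B D P \<tau> (Suc t) *\<^sub>v z t) = n"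
    "dim_vec (R (Suc t) *\<^sub>v a t + C *\<^sub>v z t) = b"
    by (auto simp: Pbar_phi_def Cmat_def)
  show "a (Suc t) = W (Suc t) *\<^sub>v a t + Pbar_phi G n B D P \<tau> (Suc t) *\<^sub>v z t"
    unfolding a_def x using dims by (intro eq_vecI) (auto simp: vec_first_def a_def z_def)
  show "z (Suc t) = R (Suc t) *\<^sub>v a t + C *\<^sub>v z t"
    unfolding z_def x using dims by (intro eq_vecI) (auto simp: vec_last_def a_def z_def)
qed

lemma x_node:
  assumes "j < n"
  shows "vec_first (x t) n $ j = x t $ j"
  using assms by (simp add: vec_first_def)

text \<open>This is \<open>delay_line\<close> at the end of a chain, \<open>k = l\<close>, with the
  compute part of the state as input.\<close>

lemma delay_values:
  assumes "d < b" "D d = ((j, i), l, l)" "l \<in> arrivals t j i"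
  shows "vec_last (x t) b $ d = x (t - l) $ j"
proof -
  have "vec_last (x 0) b = 0\<^sub>v b"
    using u_carrier by (intro eq_vecI) (auto simp: vec_last_def)
  from delay_line[OF this x_Suc(2) _ assms(1,2)] assms(3) show ?thesis
    by (auto simp: arrivals_def x_node dest: proper_lt)
qed

text \<open>Undelayed messages enter as age 0, so both blocks merge into one sum over all
  arrivals.\<close>

lemma node_update:
  assumes i: "i < n"
  shows "x (Suc t) $ i = (1 - received t i) * x t $ i
    + (\<Sum>j<n. \<Sum>l\<in>arrivals t j i. share t i j * x (t - l) $ j)"
proof -
  have "x (Suc t) $ i = (W (Suc t) *\<^sub>v vec_first (x t) n) $ i
      + (Pbar_phi G n B D P \<tau> (Suc t) *\<^sub>v vec_last (x t) b) $ i"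
    using i x_Suc(1)[of t] x_node[OF i, of "Suc t"] by (simp add: Pbar_phi_def del: xhat.simps)
  also have "(W (Suc t) *\<^sub>v vec_first (x t) n) $ i = (1 - received t i) * x t $ i
      + (\<Sum>j<n. \<Sum>l\<in>arrivals t j i \<inter> {0}. share t i j * x (t - l) $ j)"
    using i by (subst W_mult) (auto simp: Pbar_L_mult x_node intro!: sum.cong)
  also have "(Pbar_phi G n B D P \<tau> (Suc t) *\<^sub>v vec_last (x t) b) $ i =
      (\<Sum>j<n. \<Sum>l\<in>arrivals t j i - {0}. share t i j * x (t - l) $ j)"
    using i delay_values by (intro Pbar_phi_mult) auto
  finally show ?thesis
    by (simp add: sum.distrib flip: sum_arrivals_split)
qed

text \<open>The mass \<open>1 - received t i\<close> not claimed by arriving messages stays on the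
  node's own current value.\<close>

definition weight :: "nat \<Rightarrow> nat \<Rightarrow> nat \<Rightarrow> nat \<Rightarrow> real" where
  "weight t i j l = (if l \<in> arrivals t j i then share t i j else 0)
     + (if j = i \<and> l = 0 then 1 - received t i else 0)"

lemma arrivals_subset: "arrivals t j i \<subseteq> {..B}"
  by (auto simp: arrivals_def)

text \<open>Delayed states as \<open>f\<close> give the update formula, the constant 1 gives the
  total weight.\<close>

lemma sum_weight:
  assumes "i < n"
  shows "(\<Sum>j<n. \<Sum>l\<le>B. weight t i j l * f j l) = (1 - received t i) * f i 0
    + (\<Sum>j<n. \<Sum>l\<in>arrivals t j i. share t i j * f j l)"
proof -
  have "(\<Sum>l\<le>B. weight t i j l * f j l) = (\<Sum>l\<in>arrivals t j i. share t i j * f j l)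
      + (if j = i then (1 - received t i) * f i 0 else 0)" for j
  proof -
    have "(\<Sum>l\<le>B. weight t i j l * f j l) =
        (\<Sum>l\<le>B. if l \<in> arrivals t j i then share t i j * f j l else 0)
        + (\<Sum>l\<le>B. if l = 0 then if j = i then (1 - received t i) * f i 0 else 0 else 0)"
      unfolding sum.distrib[symmetric] by (intro sum.cong) (auto simp: weight_def algebra_simps)
    also have "(\<Sum>l\<le>B. if l \<in> arrivals t j i then share t i j * f j l else 0) =
        (\<Sum>l\<in>arrivals t j i. share t i j * f j l)"
      using arrivals_subset by (subst sum.inter_restrict[symmetric]) (auto simp: Int_absorb1)
    finally show ?thesis by simp
  qed
  then show ?thesis using assms by (simp add: sum.distrib)
qed

section \<open>Uniform lower bounds on the weights\<close>

lemma P_nonneg: "i < n \<Longrightarrow> j < n \<Longrightarrow> P $$ (i, j) \<ge> 0"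
  and P_sum: "i < n \<Longrightarrow> (\<Sum>j<n. P $$ (i, j)) = 1"
  using stochastic by (auto simp: row_stochastic_def)

text \<open>A node heard from contributes its whole entry of \<open>P\<close>, a silent one nothing,
  and \<open>i\<close> never sends to itself because \<open>proper_edges\<close> has no loops. So
  the self-weight is at least \<open>P $$ (i, i)\<close>.\<close>

lemma received_le:
  assumes "i < n"
  shows "received t i \<le> 1 - P $$ (i, i)"
proof -
  have "(\<Sum>l\<in>arrivals t j i. share t i j) \<le> (if j = i then 0 else P $$ (i, j))" if "j < n" for j
  proof (cases "j = i")
    case True
    then have "arrivals t j i = {}" by (auto simp: arrivals_def dest: proper_lt)
    then show ?thesis using True by simp
  next
    case False
    then show ?thesis
      using P_nonneg[OF assms that] by (cases "card (arrivals t j i) = 0") auto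
  qed
  then have "received t i \<le> (\<Sum>j<n. if j = i then 0 else P $$ (i, j))"
    unfolding received_def by (intro sum_mono) auto
  also have "\<dots> = (\<Sum>j<n. P $$ (i, j) - (if j = i then P $$ (i, i) else 0))"
    by (intro sum.cong) auto
  also have "\<dots> = 1 - P $$ (i, i)"
    using assms by (simp add: sum_subtractf P_sum)
  finally show ?thesis .
qed

text \<open>The divisor is the largest possible number of messages from one sender that arrive
  together. The default 1 keeps zero entries of \<open>P\<close> from spoiling positivity.\<close>

definition min_weight :: real where
  "min_weight = Min ((\<lambda>(i, j). if P $$ (i, j) > 0 then P $$ (i, j) / (B + 1) else 1) ` ({..<n} \<times> {..<n}))"

lemma min_weight_le: "i < n \<Longrightarrow> j < n \<Longrightarrow> P $$ (i, j) > 0 \<Longrightarrow> min_weight \<le> P $$ (i, j) / (B + 1)"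
  unfolding min_weight_def by (intro Min_le) force+

lemma n_pos: "n > 0"
  using strong verts by (auto simp: strongly_connected_def)

lemma min_weight_pos: "min_weight > 0"
  unfolding min_weight_def using n_pos by (subst Min_gr_iff) auto

lemma share_ge:
  assumes "l \<in> arrivals t j i"
  shows "min_weight \<le> share t i j"
proof -
  have e: "(j, i) \<in> proper_edges G" using assms by (simp add: arrivals_def)
  then have pos: "P $$ (i, j) > 0" "i < n" "j < n"
    using respects proper_lt[OF e] by (auto simp: respects_graph_def proper_edges_def)
  have "card (arrivals t j i) > 0" using assms by (auto simp: card_gt_0_iff)
  moreover have "real (card (arrivals t j i)) \<le> real (B + 1)"
    using card_arrivals_le by (rule of_nat_mono)
  ultimately have "P $$ (i, j) / (B + 1) \<le> share t i j"
    using pos by (intro divide_left_mono) auto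
  with min_weight_le pos show ?thesis by fastforce
qed

lemma share_nonneg: "i < n \<Longrightarrow> j < n \<Longrightarrow> share t i j \<ge> 0"
  using P_nonneg by auto

text \<open>Removing self-loops does not change the reflexive transitive closure.\<close>

lemma connected: "{..<n} \<times> {..<n} \<subseteq> (proper_edges G)\<^sup>*"
proof
  interpret pair_fin_digraph G by (rule fin_digraph)
  fix p :: "nat \<times> nat" assume "p \<in> {..<n} \<times> {..<n}"
  then have "fst p \<rightarrow>\<^sup>*\<^bsub>G\<^esub> snd p"
    using strong verts by (auto simp: strongly_connected_def)
  then have "p \<in> (parcs G)\<^sup>*"
    by (auto dest: reachable_rtranclI)
  moreover have "proper_edges G = parcs G - Id"
    by (auto simp: proper_edges_def)
  ultimately show "p \<in> (proper_edges G)\<^sup>*"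
    by (simp add: rtrancl_r_diff_Id)
qed

sublocale delayed_averaging "{..<n}" "proper_edges G" B min_weight weight "\<lambda>t i. x t $ i"
proof
  fix i t assume "i \<in> {..<n}"
  then have i: "i < n" by simp
  show "x (Suc t) $ i = (\<Sum>j<n. \<Sum>l\<le>B. weight t i j l * x (t - l) $ j)"
    using i sum_weight[OF i, of t "\<lambda>j l. x (t - l) $ j"] by (simp add: node_update del: xhat.simps)
  show "(\<Sum>j<n. \<Sum>l\<le>B. weight t i j l) = 1"
    using sum_weight[OF i, of t "\<lambda>_ _. 1"] by (simp add: received_def)
  have "P $$ (i, i) > 0"
    using i respects by (simp add: respects_graph_def)
  moreover from this have "P $$ (i, i) / (B + 1) \<le> P $$ (i, i)"
    by (simp add: field_simps)
  ultimately have "min_weight \<le> P $$ (i, i)"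
    using min_weight_le[OF i i] by simp
  then show "weight t i i 0 \<ge> min_weight"
    using received_le[OF i, of t] share_nonneg[OF i i, of t] by (simp add: weight_def)
  fix j l assume "j \<in> {..<n}"
  then show "weight t i j l \<ge> 0"
    using i share_nonneg[OF i, of j t] received_le[OF i, of t] P_nonneg[OF i i]
    by (auto simp: weight_def)
next
  fix j i t assume e: "(j, i) \<in> proper_edges G"
  then have "i < n" "j < n" "j \<noteq> i" using proper_lt by auto
  \<comment> \<open>A message of iteration \<open>Suc t\<close> with delay \<open>l\<close> is read
    in the step from \<open>t + l\<close>, because \<open>Suc (t + l) - l = Suc t\<close>; its delay
    is the required lag.\<close>
  moreover have "\<tau> (j, i) (Suc t) \<in> arrivals (t + \<tau> (j, i) (Suc t)) j i"
    using e delay_le[OF e, of "Suc t"] by (simp add: arrivals_def)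
  ultimately show "\<exists>l\<le>B. min_weight \<le> weight (t + l) i j l"
    using share_ge delay_le[OF e, of "Suc t"]
    by (intro exI[of _ "\<tau> (j, i) (Suc t)"]) (auto simp: weight_def)
qed (use n_pos min_weight_pos connected proper_lt in auto)

end

text \<open>\<open>v\<close> lies on the segment between a least and a greatest value, so two points
  can carry all the weight.\<close>

lemma between_Min_Max_convex_combination:
  fixes f :: "'a \<Rightarrow> real"
  assumes "finite A" "A \<noteq> {}" "Min (f ` A) \<le> v" "v \<le> Max (f ` A)"
  shows "\<exists>a. (\<forall>i\<in>A. a i \<ge> 0) \<and> sum a A = 1 \<and> v = (\<Sum>i\<in>A. a i * f i)"
proof -
  have "Min (f ` A) \<in> f ` A" "Max (f ` A) \<in> f ` A"
    using assms by (auto intro!: Min_in Max_in)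
  then obtain p q where pq: "p \<in> A" "q \<in> A" "f p = Min (f ` A)" "f q = Max (f ` A)"
    by (auto simp: image_iff)
  then have "v \<in> closed_segment (f p) (f q)"
    using assms by (auto simp: closed_segment_eq_real_ivl)
  then obtain s where s: "0 \<le> s" "s \<le> 1" "v = (1 - s) * f p + s * f q"
    by (auto simp: in_segment)
  \<comment> \<open>Adding two indicator terms also covers \<open>p = q\<close>, where both weights
    fall on the same point.\<close>
  have "(\<Sum>i\<in>A. ((if i = p then 1 - s else 0) + (if i = q then s else 0)) * f i) =
      (\<Sum>i\<in>A. (if i = p then (1 - s) * f p else 0) + (if i = q then s * f q else 0))"
    by (intro sum.cong) (auto simp: algebra_simps)
  with pq s assms(1) show ?thesis
    by (intro exI[of _ "\<lambda>i. (if i = p then 1 - s else 0) + (if i = q then s else 0)"])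
      (auto simp: sum.distrib)
qed

section \<open>From bounded delays to almost sure consensus\<close>

theorem corollary2:
  fixes G :: "nat pair_pre_digraph" and n B :: nat and P :: "real mat"
    and M :: "'w measure" and \<tau> :: "edge \<Rightarrow> nat \<Rightarrow> 'w \<Rightarrow> nat" and Q :: "nat pmf"
    and D :: "nat \<Rightarrow> delay_node" and u :: "real vec"
  assumes "pair_fin_digraph G" and "pverts G = {..<n}" and "strongly_connected G"
    and "row_stochastic n P" and "respects_graph n P G"
    and "B \<ge> 1"
    and "prob_space M"
    and "prob_space.indep_vars M (\<lambda>_. count_space UNIV) (\<lambda>(e, t). \<tau> e t)
           (proper_edges G \<times> {1..})"
    and "\<And>e t. e \<in> proper_edges G \<Longrightarrow> t \<ge> 1 \<Longrightarrow>
           distr M (count_space UNIV) (\<tau> e t) = measure_pmf Q"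
    and "set_pmf Q \<subseteq> {0..B}"
    and "bij_betw D {..<num_delay G B} (delay_nodes G B)"
    and "u \<in> carrier_vec n"
  shows "AE \<omega> in M. \<exists>v::real.
           (\<forall>i<n. (\<lambda>t. xhat G n B D P u (\<lambda>e t. \<tau> e t \<omega>) t $ i) \<longlonglongrightarrow> v)
           \<and> (\<exists>a :: nat \<Rightarrow> real. (\<forall>i<n. a i \<ge> 0) \<and> (\<Sum>i<n. a i) = 1
                 \<and> v = (\<Sum>i<n. a i * xhat G n B D P u (\<lambda>e t. \<tau> e t \<omega>) 0 $ i))"
proof -
  interpret prob_space M by fact
  have "AE \<omega> in M. \<tau> e t \<omega> \<le> B" if "e \<in> proper_edges G" "t \<ge> 1" for e t
  proof (rule AE_distrD[where P = "\<lambda>k. k \<le> B"])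
    show "\<tau> e t \<in> measurable M (count_space UNIV)"
      using assms(8) that by (auto simp: indep_vars_def)
    show "AE k in distr M (count_space UNIV) (\<tau> e t). k \<le> B"
      unfolding assms(9)[OF that] using assms(10) by (auto simp: AE_measure_pmf_iff)
  qed
  \<comment> \<open>There are countably many pairs of an edge and an iteration, so one null set
    serves them all.\<close>
  then have "AE \<omega> in M. \<forall>p\<in>proper_edges G \<times> {1..}. \<tau> (fst p) (snd p) \<omega> \<le> B"
    by (subst AE_ball_countable) auto
  then show ?thesis
  proof eventually_elim
    case (elim \<omega>)
    interpret delay_system G n B P D u "\<lambda>e t. \<tau> e t \<omega>"
      using assms(1-5,11,12) elim by (intro delay_system.intro) auto
    obtain v where v: "\<forall>i\<in>{..<n}. (\<lambda>t. x t $ i) \<longlonglongrightarrow> v"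
      "Min ((\<lambda>i. x 0 $ i) ` {..<n}) \<le> v" "v \<le> Max ((\<lambda>i. x 0 $ i) ` {..<n})"
      using consensus by blast
    with between_Min_Max_convex_combination[OF _ _ v(2,3)] n_pos show ?case
      by (intro exI[of _ v]) auto
  qed
qed

end
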